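(* Let $\Delta t>0$ be arbitrary and let $(\phi^n,q^n,u^n)_{n\ge 0}$ and $(\mu^{n+1/2})_{n\ge 0}$ satisfy, for every $n\ge 0$, the double IEQ Crank--Nicolson scheme $$\frac{\phi^{n+1}-\phi^{n}}{\Delta t}=\mathcal{G}\mu^{n+1/2},$$ $$\mu^{n+1/2}=\mathcal{L}\left(\frac{\phi^{n+1}+\phi^n}{2}\right)+\frac{q^{n+1}+q^n}{2\sqrt{\widetilde{F}(\tilde{\phi}^{n+1/2})+\kappa}}\widetilde{F}'(\tilde{\phi}^{n+1/2})-\frac{u^{n+1}+u^n}{2\sqrt{M(\tilde{\phi}^{n+1/2})+\kappa}}M'(\tilde{\phi}^{n+1/2}),$$ $$\frac{q^{n+1}-q^n}{\Delta t}=\frac{\widetilde{F}'(\tilde{\phi}^{n+1/2})}{2\sqrt{\widetilde{F}(\tilde{\phi}^{n+1/2})+\kappa}}\,\frac{\phi^{n+1}-\phi^{n}}{\Delta t},$$ $$\frac{u^{n+1}-u^n}{\Delta t}=\frac{M'(\tilde{\phi}^{n+1/2})}{2\sqrt{M(\tilde{\phi}^{n+1/2})+\kappa}}\,\frac{\phi^{n+1}-\phi^{n}}{\Delta t}.$$ Define $$E^{n}_{IEQ-CN}=\frac12(\mathcal{L}\phi^{n},\phi^{n})+\|q^{n}\|^2-\|u^{n}\|^2 .$$ Then the scheme is unconditionally energy stable in the sense that, for every $n\ge 0$, $$E_{IEQ-CN}^{n+1}-E^{n}_{IEQ-CN}\leq\Delta t\,(\mathcal{G}\mu^{n+1/2},\mu^{n+1/2})\leq0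 .$$
   Context: $(\cdot,\cdot)$ and $\|\cdot\|$ are the $L^2(\Omega)$ inner product and norm over real-valued functions on a domain $\Omega$. The phase field model is $\partial\phi/\partial t=\mathcal{G}\mu$, where $\mathcal{L}$ is a symmetric non-negative linear operator and $\mathcal{G}$ is a non-positive linear operator on $L^2(\Omega)$, i.e. $(\mathcal{L}v,w)=(v,\mathcal{L}w)$, $(\mathcal{L}v,v)\ge 0$ and $(\mathcal{G}v,v)\le 0$. $F$ is the (real, differentiable) nonlinear energy density, $M$ is a differentiable non-negative function chosen so that $\widetilde{F}(\phi)=F(\phi)+M(\phi)\ge 0$ for all real $\phi$, and $\kappa\ge 0$ is a constant ensuring that $\widetilde F+\kappa$ and $M+\kappa$ do not vanish, so that the denominators are nonzero. Functions of $\phi$ are applied pointwise on $\Omega$. The scheme is semi-discrete (discrete in time only): $\phi^n,q^n,u^n,\mu^{n+1/2}$ are real-valued functions on $\Omega$, regular enough for all expressions to make sense. The unknowns $q$ and $u$ approximate $\sqrt{\widetilde F(\phi)+\kappa}$ and $\sqrt{M(\phi)+\kappa}$, and the initial values are $q^0=\sqrt{\widetilde F(\phi^0)+\kappa}$, $u^0=\sqrt{M(\phi^0)+\kappa}$. Here $\tilde\phi^{n+1/2}$ is an explicit $O(\Delta t^2)$ approximation of $\phi(t^{n+1/2})$: $\tilde\phi^{n+1/2}=(3\phi^n-\phi^{n-1})/2$ for $n\ge1$, and $\tilde\phi^{1/2}$ is determined by $\dfrac{\tilde\phi^{1/2}-\phi^0}{\Delta t/2}=\mathcal{G}\left(\mathcal{L}\tilde\phi^{1/2}+F'(\phi^0)\right)$.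 "Unconditionally" means with no restriction on $\Delta t>0$. *)

theory Defs
  imports "HOL-Analysis.Analysis"
begin

text \<open>
  Elements of \<open>L\<^sup>2(\<Omega>)\<close> are represented by functions on the ambient Euclidean space; only their
  values on \<open>\<Omega>\<close>, up to Lebesgue null sets, matter.  Equations between elements of \<open>L\<^sup>2(\<Omega>)\<close>
  therefore hold almost everywhere in \<open>\<Omega>\<close>.
\<close>

definition L2 :: "'a::euclidean_space set \<Rightarrow> ('a \<Rightarrow> real) set" where
  "L2 \<Omega> = {v. v \<in> borel_measurable (lebesgue_on \<Omega>) \<and> integrable (lebesgue_on \<Omega>) (\<lambda>x. (v x)\<^sup>2)}"

definition L2_inner :: "'a::euclidean_space set \<Rightarrow> ('a \<Rightarrow> real) \<Rightarrow> ('a \<Rightarrow> real) \<Rightarrow> real" where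
  "L2_inner \<Omega> v w = integral\<^sup>L (lebesgue_on \<Omega>) (\<lambda>x. v x * w x)"

definition L2_norm :: "'a::euclidean_space set \<Rightarrow> ('a \<Rightarrow> real) \<Rightarrow> real" where
  "L2_norm \<Omega> v = sqrt (L2_inner \<Omega> v v)"

text \<open>
  A linear operator \<open>T\<close> in \<open>L\<^sup>2(\<Omega>)\<close> with domain \<open>D\<close>.  The domain is a linear subspace of
  \<open>L\<^sup>2(\<Omega>)\<close>, possibly proper, so that unbounded differential operators (with their boundary
  conditions) are included; \<open>D = L2 \<Omega>\<close> is the everywhere defined case.  The last conjunct
  says that \<open>T\<close> acts on almost-everywhere classes.
\<close>

definition linear_operator_L2 ::
  "'a::euclidean_space set \<Rightarrow> ('a \<Rightarrow> real) set \<Rightarrow> (('a \<Rightarrow> real) \<Rightarrow> 'a \<Rightarrow> real) \<Rightarrow> bool" where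
  "linear_operator_L2 \<Omega> D T \<longleftrightarrow>
     D \<subseteq> L2 \<Omega> \<and> D \<noteq> {} \<and>
     (\<forall>v\<in>D. \<forall>w\<in>D. \<forall>a b. (\<lambda>x. a * v x + b * w x) \<in> D) \<and>
     (\<forall>v\<in>D. T v \<in> L2 \<Omega>) \<and>
     (\<forall>v\<in>D. \<forall>w\<in>D. \<forall>a b.
        AE x in lebesgue_on \<Omega>. T (\<lambda>y. a * v y + b * w y) x = a * T v x + b * T w x) \<and>
     (\<forall>v\<in>D. \<forall>w\<in>D. (AE x in lebesgue_on \<Omega>. v x = w x) \<longrightarrow>
        (AE x in lebesgue_on \<Omega>. T v x = T w x))"

definition symmetric_operator_L2 ::
  "'a::euclidean_space set \<Rightarrow> ('a \<Rightarrow> real) set \<Rightarrow> (('a \<Rightarrow> real) \<Rightarrow> 'a \<Rightarrow> real) \<Rightarrow> bool" where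
  "symmetric_operator_L2 \<Omega> D T \<longleftrightarrow> (\<forall>v\<in>D. \<forall>w\<in>D. L2_inner \<Omega> (T v) w = L2_inner \<Omega> v (T w))"

definition nonneg_operator_L2 ::
  "'a::euclidean_space set \<Rightarrow> ('a \<Rightarrow> real) set \<Rightarrow> (('a \<Rightarrow> real) \<Rightarrow> 'a \<Rightarrow> real) \<Rightarrow> bool" where
  "nonneg_operator_L2 \<Omega> D T \<longleftrightarrow> (\<forall>v\<in>D. L2_inner \<Omega> (T v) v \<ge> 0)"

definition nonpos_operator_L2 ::
  "'a::euclidean_space set \<Rightarrow> ('a \<Rightarrow> real) set \<Rightarrow> (('a \<Rightarrow> real) \<Rightarrow> 'a \<Rightarrow> real) \<Rightarrow> bool" where
  "nonpos_operator_L2 \<Omega> D T \<longleftrightarrow> (\<forall>v\<in>D. L2_inner \<Omega> (T v) v \<le> 0)"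

definition shifted_energy :: "(real \<Rightarrow> real) \<Rightarrow> (real \<Rightarrow> real) \<Rightarrow> real \<Rightarrow> real" where
  "shifted_energy F M s = F s + M s"

text \<open>The midpoint approximation \<open>\<psi> n\<close> stands for \<open>\<phi>\<close> at time \<open>(n + 1/2) \<Delta>t\<close>.\<close>

definition midpoint_approximation ::
  "'a::euclidean_space set \<Rightarrow> ('a \<Rightarrow> real) set \<Rightarrow> (('a \<Rightarrow> real) \<Rightarrow> 'a \<Rightarrow> real) \<Rightarrow>
   ('a \<Rightarrow> real) set \<Rightarrow> (('a \<Rightarrow> real) \<Rightarrow> 'a \<Rightarrow> real) \<Rightarrow> (real \<Rightarrow> real) \<Rightarrow> real \<Rightarrow>
   (nat \<Rightarrow> 'a \<Rightarrow> real) \<Rightarrow> (nat \<Rightarrow> 'a \<Rightarrow> real) \<Rightarrow> bool" where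
  "midpoint_approximation \<Omega> DL L DG G F \<Delta>t \<phi> \<psi> \<longleftrightarrow>
     \<psi> 0 \<in> DL \<and>
     (\<lambda>x. L (\<psi> 0) x + deriv F (\<phi> 0 x)) \<in> DG \<and>
     (AE x in lebesgue_on \<Omega>.
        (\<psi> 0 x - \<phi> 0 x) / (\<Delta>t / 2) = G (\<lambda>y. L (\<psi> 0) y + deriv F (\<phi> 0 y)) x) \<and>
     (\<forall>n\<ge>1. AE x in lebesgue_on \<Omega>. \<psi> n x = (3 * \<phi> n x - \<phi> (n - 1) x) / 2)"

text \<open>
  One step of the scheme; \<open>\<mu> n\<close> stands for the chemical potential at time \<open>(n + 1/2) \<Delta>t\<close>.
\<close>

definition double_IEQ_CN_step ::
  "'a::euclidean_space set \<Rightarrow> (('a \<Rightarrow> real) \<Rightarrow> 'a \<Rightarrow> real) \<Rightarrow> (('a \<Rightarrow> real) \<Rightarrow> 'a \<Rightarrow> real) \<Rightarrow>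
   (real \<Rightarrow> real) \<Rightarrow> (real \<Rightarrow> real) \<Rightarrow> real \<Rightarrow> real \<Rightarrow>
   (nat \<Rightarrow> 'a \<Rightarrow> real) \<Rightarrow> (nat \<Rightarrow> 'a \<Rightarrow> real) \<Rightarrow> (nat \<Rightarrow> 'a \<Rightarrow> real) \<Rightarrow>
   (nat \<Rightarrow> 'a \<Rightarrow> real) \<Rightarrow> (nat \<Rightarrow> 'a \<Rightarrow> real) \<Rightarrow> nat \<Rightarrow> bool" where
  "double_IEQ_CN_step \<Omega> L G F M \<kappa> \<Delta>t \<phi> \<psi> q u \<mu> n \<longleftrightarrow>
     (AE x in lebesgue_on \<Omega>. (\<phi> (Suc n) x - \<phi> n x) / \<Delta>t = G (\<mu> n) x) \<and>
     (AE x in lebesgue_on \<Omega>.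
        \<mu> n x = L (\<lambda>y. (\<phi> (Suc n) y + \<phi> n y) / 2) x
          + (q (Suc n) x + q n x) / (2 * sqrt (shifted_energy F M (\<psi> n x) + \<kappa>))
              * deriv (shifted_energy F M) (\<psi> n x)
          - (u (Suc n) x + u n x) / (2 * sqrt (M (\<psi> n x) + \<kappa>)) * deriv M (\<psi> n x)) \<and>
     (AE x in lebesgue_on \<Omega>.
        (q (Suc n) x - q n x) / \<Delta>t
          = deriv (shifted_energy F M) (\<psi> n x) / (2 * sqrt (shifted_energy F M (\<psi> n x) + \<kappa>))
              * ((\<phi> (Suc n) x - \<phi> n x) / \<Delta>t)) \<and>
     (AE x in lebesgue_on \<Omega>.
        (u (Suc n) x - u n x) / \<Delta>t
          = deriv M (\<psi> n x) / (2 * sqrt (M (\<psi> n x) + \<kappa>))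
              * ((\<phi> (Suc n) x - \<phi> n x) / \<Delta>t))"

definition energy_IEQ_CN ::
  "'a::euclidean_space set \<Rightarrow> (('a \<Rightarrow> real) \<Rightarrow> 'a \<Rightarrow> real) \<Rightarrow>
   (nat \<Rightarrow> 'a \<Rightarrow> real) \<Rightarrow> (nat \<Rightarrow> 'a \<Rightarrow> real) \<Rightarrow> (nat \<Rightarrow> 'a \<Rightarrow> real) \<Rightarrow> nat \<Rightarrow> real" where
  "energy_IEQ_CN \<Omega> L \<phi> q u n =
     1 / 2 * L2_inner \<Omega> (L (\<phi> n)) (\<phi> n) + (L2_norm \<Omega> (q n))\<^sup>2 - (L2_norm \<Omega> (u n))\<^sup>2"

end

theory Submission
  imports Defs
begin

text \<open>
  Testing the equation for \<open>\<mu>\<close> with \<open>\<phi>\<^sup>n\<^sup>+\<^sup>1 - \<phi>\<^sup>n = \<Delta>t G\<mu>\<close> produces the increments of the energy: the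
  nonlinear terms telescope pointwise to differences of squares of \<open>q\<close> and \<open>u\<close>, because their
  coefficients are those of the evolution equations for \<open>q\<close> and \<open>u\<close>, and the quadratic term
  telescopes after integration by the symmetry of \<open>L\<close>.  The energy inequality is therefore an
  equality, and its right-hand side is nonpositive since \<open>G\<close> is.
\<close>

lemma integrable_mult_L2:
  assumes "v \<in> L2 \<Omega>" "w \<in> L2 \<Omega>"
  shows "integrable (lebesgue_on \<Omega>) (\<lambda>x. v x * w x)"
proof (rule Bochner_Integration.integrable_bound)
  show "integrable (lebesgue_on \<Omega>) (\<lambda>x. (v x)\<^sup>2 + (w x)\<^sup>2)"
    using assms by (simp add: L2_def)
  show "(\<lambda>x. v x * w x) \<in> borel_measurable (lebesgue_on \<Omega>)"
    using assms unfolding L2_def by (auto intro: borel_measurable_times)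
  \<comment> \<open>The binomial bound gives \<open>2 * \<bar>a\<bar> * \<bar>b\<bar>\<close>;
    dropping the factor 2 costs nothing because the product is nonnegative, and the majorant is a
    sum of two integrable squares.\<close>
  have "\<bar>a * b\<bar> \<le> a\<^sup>2 + b\<^sup>2" for a b :: real
    using sum_squares_bound[of "\<bar>a\<bar>" "\<bar>b\<bar>"] mult_nonneg_nonneg[of "\<bar>a\<bar>" "\<bar>b\<bar>"]
    unfolding abs_mult power2_abs by linarith
  then show "AE x in lebesgue_on \<Omega>. norm (v x * w x) \<le> norm ((v x)\<^sup>2 + (w x)\<^sup>2)"
    by simp
qed

lemma L2_norm_power2: "(L2_norm \<Omega> v)\<^sup>2 = L2_inner \<Omega> v v"
  by (simp add: L2_norm_def L2_inner_def)

lemma L2_inner_commute: "L2_inner \<Omega> v w = L2_inner \<Omega> w v"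
  by (simp add: L2_inner_def mult.commute)

text \<open>Serves to split \<open>L\<close> of the time average in the equation for
  \<open>\<mu>\<close>. Equality is only almost everywhere, since operators act on classes of
  functions.\<close>

lemma linear_operator_L2_midpoint:
  assumes "linear_operator_L2 \<Omega> D T" "v \<in> D" "w \<in> D"
  shows "AE x in lebesgue_on \<Omega>. T (\<lambda>y. (v y + w y) / 2) x = (T v x + T w x) / 2"
proof -
  have "AE x in lebesgue_on \<Omega>. T (\<lambda>y. 1/2 * v y + 1/2 * w y) x = 1/2 * T v x + 1/2 * T w x"
    using assms unfolding linear_operator_L2_def by blast
  then show ?thesis
    by (simp add: add_divide_distrib)
qed

text \<open>Everything is a value at one point, primes marking the new time level. The factor
  \<open>f / (2 * s)\<close> that multiplies \<open>q' + q\<close> in \<open>m\<close> is the one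
  that turns \<open>p' - p\<close> into \<open>q' - q\<close>, so their product is a difference of
  squares; likewise for \<open>u\<close>. The quadratic part stays expanded:
  \<open>l * p' - l' * p\<close> need not vanish pointwise.\<close>

lemma telescoped_dissipation:
  fixes \<delta> :: real
  assumes "\<delta> \<noteq> 0"
    and g: "(p' - p) / \<delta> = g"
    and m: "m = (l' + l) / 2 + (q' + q) / (2 * s) * f - (u' + u) / (2 * r) * h"
    and q: "(q' - q) / \<delta> = f / (2 * s) * ((p' - p) / \<delta>)"
    and u: "(u' - u) / \<delta> = h / (2 * r) * ((p' - p) / \<delta>)"
  shows "\<delta> * (g * m) =
    1 / 2 * (l' * p' + l * p' - l' * p - l * p) + (q' * q' - q * q) - (u' * u' - u * u)"
proof -
  have d: "\<delta> * g = p' - p" and q': "q' - q = f / (2 * s) * (p' - p)"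
    and u': "u' - u = h / (2 * r) * (p' - p)"
    using g q u \<open>\<delta> \<noteq> 0\<close> by (auto simp: field_simps)
  have "\<delta> * (g * m) = (p' - p) * m"
    by (simp flip: d)
  also have "\<dots> = (p' - p) * ((l' + l) / 2) + (q' + q) * (f / (2 * s) * (p' - p))
      - (u' + u) * (h / (2 * r) * (p' - p))"
    by (simp add: m algebra_simps)
  also have "\<dots> = (p' - p) * ((l' + l) / 2) + (q' + q) * (q' - q) - (u' + u) * (u' - u)"
    by (simp only: q' u')
  finally show ?thesis
    by (simp add: field_simps)
qed

lemma double_IEQ_CN_energy_identity:
  assumes L: "linear_operator_L2 \<Omega> DL L" "symmetric_operator_L2 \<Omega> DL L"
    and G: "linear_operator_L2 \<Omega> DG G"
    and dt: "\<Delta>t \<noteq> 0"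
    and \<phi>: "\<phi> n \<in> DL" "\<phi> (Suc n) \<in> DL"
    and \<mu>: "\<mu> n \<in> DG"
    and q: "q n \<in> L2 \<Omega>" "q (Suc n) \<in> L2 \<Omega>"
    and u: "u n \<in> L2 \<Omega>" "u (Suc n) \<in> L2 \<Omega>"
    and step: "double_IEQ_CN_step \<Omega> L G F M \<kappa> \<Delta>t \<phi> \<psi> q u \<mu> n"
  shows "energy_IEQ_CN \<Omega> L \<phi> q u (Suc n) - energy_IEQ_CN \<Omega> L \<phi> q u n
    = \<Delta>t * L2_inner \<Omega> (G (\<mu> n)) (\<mu> n)"
proof -
  let ?N = "lebesgue_on \<Omega>"
  let ?rhs = "\<lambda>x. 1 / 2 * (L (\<phi> (Suc n)) x * \<phi> (Suc n) x + L (\<phi> n) x * \<phi> (Suc n) x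
      - L (\<phi> (Suc n)) x * \<phi> n x - L (\<phi> n) x * \<phi> n x)
    + (q (Suc n) x * q (Suc n) x - q n x * q n x) - (u (Suc n) x * u (Suc n) x - u n x * u n x)"
  have in_L2: "\<phi> n \<in> L2 \<Omega>" "\<phi> (Suc n) \<in> L2 \<Omega>" "L (\<phi> n) \<in> L2 \<Omega>" "L (\<phi> (Suc n)) \<in> L2 \<Omega>"
    "\<mu> n \<in> L2 \<Omega>" "G (\<mu> n) \<in> L2 \<Omega>"
    using L(1) G \<phi> \<mu> by (auto simp: linear_operator_L2_def)
  \<comment> \<open>One fact for each of the eight products in \<open>?rhs\<close>; they justify
    integrating it term by term.\<close>
  note int = integrable_mult_L2[OF in_L2(4,2)] integrable_mult_L2[OF in_L2(3,2)]
    integrable_mult_L2[OF in_L2(4,1)] integrable_mult_L2[OF in_L2(3,1)]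
    integrable_mult_L2[OF q(2,2)] integrable_mult_L2[OF q(1,1)]
    integrable_mult_L2[OF u(2,2)] integrable_mult_L2[OF u(1,1)]
  have pointwise: "AE x in ?N. \<Delta>t * (G (\<mu> n) x * \<mu> n x) = ?rhs x"
    using step[unfolded double_IEQ_CN_step_def, THEN conjunct1]
      step[unfolded double_IEQ_CN_step_def, THEN conjunct2, THEN conjunct1]
      step[unfolded double_IEQ_CN_step_def, THEN conjunct2, THEN conjunct2, THEN conjunct1]
      step[unfolded double_IEQ_CN_step_def, THEN conjunct2, THEN conjunct2, THEN conjunct2]
      linear_operator_L2_midpoint[OF L(1) \<phi>(2,1)]
  proof eventually_elim
    case (elim x)
    show ?case
      \<comment> \<open>\<open>elim(5)\<close> replaces \<open>L\<close> of the average by the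
        average of \<open>L (\<phi> (Suc n))\<close> and \<open>L (\<phi> n)\<close>, which gives
        the equation for \<open>\<mu>\<close> the shape of \<open>m\<close>.\<close>
      by (rule telescoped_dissipation[OF dt elim(1) elim(2)[unfolded elim(5)] elim(3,4)])
  qed
  have "\<Delta>t * L2_inner \<Omega> (G (\<mu> n)) (\<mu> n) = integral\<^sup>L ?N (\<lambda>x. \<Delta>t * (G (\<mu> n) x * \<mu> n x))"
    by (simp add: L2_inner_def)
  also have "\<dots> = integral\<^sup>L ?N ?rhs"
  proof (rule integral_cong_AE)
    show "(\<lambda>x. \<Delta>t * (G (\<mu> n) x * \<mu> n x)) \<in> borel_measurable ?N"
      using integrable_mult_L2[OF in_L2(6,5)] by simp
    show "?rhs \<in> borel_measurable ?N"
      using int by (intro borel_measurable_integrable) simp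
  qed (fact pointwise)
  also have "\<dots> = 1 / 2 * (L2_inner \<Omega> (L (\<phi> (Suc n))) (\<phi> (Suc n)) + L2_inner \<Omega> (L (\<phi> n)) (\<phi> (Suc n))
      - L2_inner \<Omega> (L (\<phi> (Suc n))) (\<phi> n) - L2_inner \<Omega> (L (\<phi> n)) (\<phi> n))
    + (L2_inner \<Omega> (q (Suc n)) (q (Suc n)) - L2_inner \<Omega> (q n) (q n))
    - (L2_inner \<Omega> (u (Suc n)) (u (Suc n)) - L2_inner \<Omega> (u n) (u n))"
    using int by (simp add: L2_inner_def)
  \<comment> \<open>The mixed terms agree only as integrals: symmetry moves \<open>L\<close> to the
    other argument, and commuting the inner product brings it back in front. They then
    cancel.\<close>
  also have "L2_inner \<Omega> (L (\<phi> n)) (\<phi> (Suc n)) = L2_inner \<Omega> (L (\<phi> (Suc n))) (\<phi> n)"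
    using L(2) \<phi> by (metis symmetric_operator_L2_def L2_inner_commute)
  finally show ?thesis
    by (simp add: energy_IEQ_CN_def L2_norm_power2 algebra_simps)
qed

theorem theorem2p2:
  fixes \<Omega> :: "'a::euclidean_space set"
    and L G :: "('a \<Rightarrow> real) \<Rightarrow> 'a \<Rightarrow> real"
    and DL DG :: "('a \<Rightarrow> real) set"
    and F M :: "real \<Rightarrow> real"
    and \<kappa> \<Delta>t :: real
    and \<phi> \<psi> q u \<mu> :: "nat \<Rightarrow> 'a \<Rightarrow> real"
  assumes domain: "open \<Omega>" "connected \<Omega>" "\<Omega> \<noteq> {}"
    and L_op: "linear_operator_L2 \<Omega> DL L" "symmetric_operator_L2 \<Omega> DL L" "nonneg_operator_L2 \<Omega> DL L"
    and G_op: "linear_operator_L2 \<Omega> DG G" "nonpos_operator_L2 \<Omega> DG G"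
    and F_diff: "\<forall>s. F differentiable at s"
    and M_diff: "\<forall>s. M differentiable at s"
    and M_nonneg: "\<forall>s. M s \<ge> 0"
    and shifted_nonneg: "\<forall>s. shifted_energy F M s \<ge> 0"
    and kappa: "\<kappa> \<ge> 0" "\<forall>s. shifted_energy F M s + \<kappa> \<noteq> 0" "\<forall>s. M s + \<kappa> \<noteq> 0"
    and dt: "\<Delta>t > 0"
    and regular: "\<forall>n. \<phi> n \<in> DL" "\<forall>n. \<mu> n \<in> DG" "\<forall>n. q n \<in> L2 \<Omega>" "\<forall>n. u n \<in> L2 \<Omega>"
    and q_init: "AE x in lebesgue_on \<Omega>. q 0 x = sqrt (shifted_energy F M (\<phi> 0 x) + \<kappa>)"
    and u_init: "AE x in lebesgue_on \<Omega>. u 0 x = sqrt (M (\<phi> 0 x) + \<kappa>)"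
    and midpoint: "midpoint_approximation \<Omega> DL L DG G F \<Delta>t \<phi> \<psi>"
    and scheme: "\<forall>n. double_IEQ_CN_step \<Omega> L G F M \<kappa> \<Delta>t \<phi> \<psi> q u \<mu> n"
  shows "\<forall>n. energy_IEQ_CN \<Omega> L \<phi> q u (Suc n) - energy_IEQ_CN \<Omega> L \<phi> q u n
               \<le> \<Delta>t * L2_inner \<Omega> (G (\<mu> n)) (\<mu> n)
           \<and> \<Delta>t * L2_inner \<Omega> (G (\<mu> n)) (\<mu> n) \<le> 0"
proof
  fix n
  have "energy_IEQ_CN \<Omega> L \<phi> q u (Suc n) - energy_IEQ_CN \<Omega> L \<phi> q u n
      = \<Delta>t * L2_inner \<Omega> (G (\<mu> n)) (\<mu> n)"
    using L_op(1,2) G_op(1) dt regular scheme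
    by (intro double_IEQ_CN_energy_identity) auto
  \<comment> \<open>The sign of \<open>\<Delta>t\<close> matters only here; its size never does,
    hence unconditional stability.\<close>
  moreover have "\<Delta>t * L2_inner \<Omega> (G (\<mu> n)) (\<mu> n) \<le> 0"
    using G_op(2) regular(2) dt by (simp add: nonpos_operator_L2_def mult_nonneg_nonpos)
  ultimately show "energy_IEQ_CN \<Omega> L \<phi> q u (Suc n) - energy_IEQ_CN \<Omega> L \<phi> q u n
      \<le> \<Delta>t * L2_inner \<Omega> (G (\<mu> n)) (\<mu> n)
    \<and> \<Delta>t * L2_inner \<Omega> (G (\<mu> n)) (\<mu> n) \<le> 0"
    by simp
qed

end
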